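(* Let $\Gamma=\langle\alpha_1,\ldots,\alpha_r\rangle\subset A$. For each integer $j\ge 0$ let $$I_j=\big\langle \mathbf y^{\mathbf a}-\mathbf y^{\mathbf b} : \mathbf a,\mathbf b\in\mathsf Z_\Gamma(\alpha),\ \alpha\in\Gamma,\ \text{and } \big||\mathbf b|-|\mathbf a|\big|\le j\big\rangle\subset R_\Gamma .$$ These ideals form an ascending chain $$I_{\mathsf L}=I_0\subset I_1\subset I_2\subset\cdots$$ and for every $j\ge 1$ and every $\alpha\in\Gamma$, the value $\mathcal H(I_j/I_{j-1};\alpha)$ of the Hilbert function equals the number of successive length differences in $\mathsf L_\Gamma(\alpha)$ equal to $j$ (that is, writing $\mathsf L_\Gamma(\alpha)=\{\ell_1<\cdots<\ell_m\}$, the number of indices $1\le i<m$ with $\ell_{i+1}-\ell_i=j$). In particular, for $j\ge 1$, $I_{j-1}\subsetneq I_j$ if and only if $j\in\Delta(\Gamma)$.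
   Context: $\mathbb N=\{0,1,2,\ldots\}$, $\Bbbk$ is an arbitrary field, $T$ is a finite abelian group, $d\ge1$, and $A=\mathbb N^d\oplus T$. $\Gamma=\langle\alpha_1,\ldots,\alpha_r\rangle\subset A$ is a finitely generated subsemigroup (containing $0$) that is reduced ($0$ is its only invertible element), and $\alpha_1,\ldots,\alpha_r$ is its unique minimal generating set. A factorization of $\alpha\in\Gamma$ is a tuple $\mathbf a=(a_1,\ldots,a_r)\in\mathbb N^r$ with $\alpha=a_1\alpha_1+\cdots+a_r\alpha_r$; $\mathsf Z_\Gamma(\alpha)\subset\mathbb N^r$ is the set of factorizations of $\alpha$. The length of $\mathbf a$ is $|\mathbf a|=a_1+\cdots+a_r$. The length set is $\mathsf L_\Gamma(\alpha)=\{|\mathbf a|:\mathbf a\in\mathsf Z_\Gamma(\alpha)\}$. Writing $\mathsf L_\Gamma(\alpha)=\{\ell_1<\cdots<\ell_m\}$, the delta set of $\alpha$ is $\Delta(\alpha)=\{\ell_{i+1}-\ell_i:1\le i<m\}$, and $\Delta(\Gamma)=\bigcup_{\alpha\in\Gamma}\Delta(\alpha)$. $R_\Gamma=\Bbbk[y_1,\ldots,y_r]$ is the polynomial ring with $A$-grading $\deg(y_i)=\alpha_i$, and $\mathbf y^{\mathbf a}=y_1^{a_1}\cdots y_r^{a_r}$. The length set ideal is $I_{\mathsf L}=\langle\mathbf y^{\mathbf a}-\mathbf y^{\mathbf b}:\mathbf a,\mathbf b\in\mathsf Z_\Gamma(\alpha)\text{ for some }\alpha\in\Gamma\text{ and }|\mathbf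 a|=|\mathbf b|\rangle\subset R_\Gamma$. For an $A$-graded module $M=\bigoplus_{\alpha\in A}M_\alpha$ with finite-dimensional graded pieces, $\mathcal H(M;\alpha)=\dim_\Bbbk M_\alpha$. *)

theory Defs
  imports
    "HOL-Analysis.Finite_Cartesian_Product"
    "HOL-Library.Product_Plus"
    "HOL-Library.Poly_Mapping"
    "HOL-Algebra.QuotRing"
    "HOL-Algebra.Embedded_Algebras"
begin

section \<open>Finitely generated commutative monoids\<close>

definition submonoid_generated :: "'a::comm_monoid_add set \<Rightarrow> 'a set" where
  "submonoid_generated S =
     \<Inter>{M. S \<subseteq> M \<and> 0 \<in> M \<and> (\<forall>x\<in>M. \<forall>y\<in>M. x + y \<in> M)}"

definition reduced_monoid :: "'a::comm_monoid_add set \<Rightarrow> bool" where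
  "reduced_monoid G \<longleftrightarrow> (\<forall>x\<in>G. \<forall>y\<in>G. x + y = 0 \<longrightarrow> x = 0)"

text \<open>The generators are listed without repetition as \<open>\<alpha> 0, \<dots>, \<alpha> (r - 1)\<close>
  (so indices are shifted by one); values \<open>\<alpha> i\<close> with \<open>i \<ge> r\<close> are irrelevant.\<close>

definition minimal_generators :: "'a::comm_monoid_add set \<Rightarrow> nat \<Rightarrow> (nat \<Rightarrow> 'a) \<Rightarrow> bool" where
  "minimal_generators G r \<alpha> \<longleftrightarrow>
     inj_on \<alpha> {..<r} \<and> submonoid_generated (\<alpha> ` {..<r}) = G \<and>
     (\<forall>S. S \<subset> \<alpha> ` {..<r} \<longrightarrow> submonoid_generated S \<noteq> G)"


section \<open>Factorizations, length sets and delta sets\<close>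

definition nat_scale :: "nat \<Rightarrow> 'a::comm_monoid_add \<Rightarrow> 'a" where
  "nat_scale n x = (\<Sum>_<n. x)"

text \<open>A tuple in \<open>\<nat>\<^sup>r\<close> is a finitely supported function on \<^typ>\<open>nat\<close> vanishing outside
  \<open>{..<r}\<close>, so that it is also an exponent vector of a monomial in \<open>r\<close> variables.\<close>

definition factorizations ::
    "nat \<Rightarrow> (nat \<Rightarrow> 'a::comm_monoid_add) \<Rightarrow> 'a \<Rightarrow> (nat \<Rightarrow>\<^sub>0 nat) set" where
  "factorizations r \<alpha> \<beta> =
     {a. Poly_Mapping.keys a \<subseteq> {..<r} \<and>
         (\<Sum>i<r. nat_scale (Poly_Mapping.lookup a i) (\<alpha> i)) = \<beta>}"

definition fact_length :: "nat \<Rightarrow> (nat \<Rightarrow>\<^sub>0 nat) \<Rightarrow> nat" where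
  "fact_length r a = (\<Sum>i<r. Poly_Mapping.lookup a i)"

definition length_set :: "nat \<Rightarrow> (nat \<Rightarrow> 'a::comm_monoid_add) \<Rightarrow> 'a \<Rightarrow> nat set" where
  "length_set r \<alpha> \<beta> = fact_length r ` factorizations r \<alpha> \<beta>"

text \<open>The indices \<open>i\<close> with \<open>\<ell>\<^bsub>i+1\<^esub> - \<ell>\<^bsub>i\<^esub> = j\<close>, where \<open>\<ell>\<close> (\<open>ls\<close> below) is the increasing enumeration of
  the length set (counted from 0). Length sets are finite when the generated
  monoid is reduced; for infinite sets \<^const>\<open>sorted_list_of_set\<close> is meaningless.\<close>

definition gap_indices ::
    "nat \<Rightarrow> (nat \<Rightarrow> 'a::comm_monoid_add) \<Rightarrow> 'a \<Rightarrow> nat \<Rightarrow> nat set" where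
  "gap_indices r \<alpha> \<beta> j =
     (let ls = sorted_list_of_set (length_set r \<alpha> \<beta>)
      in {i. Suc i < length ls \<and> ls ! Suc i - ls ! i = j})"

definition delta_set :: "nat \<Rightarrow> (nat \<Rightarrow> 'a::comm_monoid_add) \<Rightarrow> 'a \<Rightarrow> nat set" where
  "delta_set r \<alpha> \<beta> =
     (let ls = sorted_list_of_set (length_set r \<alpha> \<beta>)
      in {ls ! Suc i - ls ! i | i. Suc i < length ls})"

definition monoid_delta_set ::
    "'a::comm_monoid_add set \<Rightarrow> nat \<Rightarrow> (nat \<Rightarrow> 'a) \<Rightarrow> nat set" where
  "monoid_delta_set G r \<alpha> = (\<Union>\<beta>\<in>G. delta_set r \<alpha> \<beta>)"


section \<open>The graded polynomial ring and its ideals\<close>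

type_synonym 'k mvpoly = "(nat \<Rightarrow>\<^sub>0 nat) \<Rightarrow>\<^sub>0 'k"

text \<open>The polynomial ring in the variables \<open>y\<^sub>0, \<dots>, y\<^bsub>r-1\<^esub>\<close>, cut out of the ring of polynomials
  in countably many variables; this includes \<open>r = 0\<close>.\<close>

definition poly_ring :: "nat \<Rightarrow> 'k::field mvpoly ring" where
  "poly_ring r =
     \<lparr>carrier = {p. \<forall>a\<in>Poly_Mapping.keys p. Poly_Mapping.keys a \<subseteq> {..<r}},
      mult = (*), one = 1, zero = 0, add = (+)\<rparr>"

lemma cring_poly_ring: "cring (poly_ring r :: 'k::field mvpoly ring)"
proof (rule cringI)
  show "abelian_group (poly_ring r :: 'k mvpoly ring)"
  proof (rule abelian_groupI)
    fix x y :: "'k mvpoly"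
    assume xy: "x \<in> carrier (poly_ring r)" "y \<in> carrier (poly_ring r)"
    show "x \<oplus>\<^bsub>poly_ring r\<^esub> y \<in> carrier (poly_ring r)"
      using xy Poly_Mapping.keys_add[of x y] by (auto simp: poly_ring_def)
  next
    fix x :: "'k mvpoly" assume x: "x \<in> carrier (poly_ring r)"
    show "\<exists>y\<in>carrier (poly_ring r). y \<oplus>\<^bsub>poly_ring r\<^esub> x = \<zero>\<^bsub>poly_ring r\<^esub>"
      using x by (intro bexI[of _ "- x"]) (auto simp: poly_ring_def in_keys_iff)
  qed (auto simp: poly_ring_def algebra_simps)
  show "comm_monoid (poly_ring r :: 'k mvpoly ring)"
  proof (rule comm_monoidI)
    fix x y :: "'k mvpoly"
    assume xy: "x \<in> carrier (poly_ring r)" "y \<in> carrier (poly_ring r)"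
    have "Poly_Mapping.keys c \<subseteq> {..<r}" if c: "c \<in> Poly_Mapping.keys (x * y)" for c
    proof -
      obtain a b where "c = a + b" "a \<in> Poly_Mapping.keys x" "b \<in> Poly_Mapping.keys y"
        using c keys_mult[of x y] by blast
      then show ?thesis
        using xy Poly_Mapping.keys_add[of a b] unfolding poly_ring_def by simp blast
    qed
    then show "x \<otimes>\<^bsub>poly_ring r\<^esub> y \<in> carrier (poly_ring r)"
      by (simp add: poly_ring_def)
  qed (auto simp: poly_ring_def algebra_simps)
qed (auto simp: poly_ring_def algebra_simps)

abbreviation monomial :: "(nat \<Rightarrow>\<^sub>0 nat) \<Rightarrow> 'k::field mvpoly" where
  "monomial a \<equiv> Poly_Mapping.single a 1"

text \<open>The degree-\<open>\<beta>\<close> part of the polynomial ring for the grading \<open>deg y\<^sub>i = \<alpha> i\<close>: the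
  monomials of degree \<open>\<beta>\<close> are those whose exponent vector is a factorization of \<open>\<beta>\<close>.\<close>

definition homogeneous_part ::
    "nat \<Rightarrow> (nat \<Rightarrow> 'a::comm_monoid_add) \<Rightarrow> 'a \<Rightarrow> 'k::field mvpoly set" where
  "homogeneous_part r \<alpha> \<beta> = {p. Poly_Mapping.keys p \<subseteq> factorizations r \<alpha> \<beta>}"

definition length_set_ideal ::
    "'a::comm_monoid_add set \<Rightarrow> nat \<Rightarrow> (nat \<Rightarrow> 'a) \<Rightarrow> 'k::field mvpoly set" where
  "length_set_ideal G r \<alpha> =
     Idl\<^bsub>poly_ring r\<^esub> {monomial a - monomial b | a b.
       (\<exists>\<beta>\<in>G. a \<in> factorizations r \<alpha> \<beta> \<and> b \<in> factorizations r \<alpha> \<beta>) \<and>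
       fact_length r a = fact_length r b}"

definition length_diff_ideal ::
    "'a::comm_monoid_add set \<Rightarrow> nat \<Rightarrow> (nat \<Rightarrow> 'a) \<Rightarrow> nat \<Rightarrow> 'k::field mvpoly set" where
  "length_diff_ideal G r \<alpha> j =
     Idl\<^bsub>poly_ring r\<^esub> {monomial a - monomial b | a b.
       (\<exists>\<beta>\<in>G. a \<in> factorizations r \<alpha> \<beta> \<and> b \<in> factorizations r \<alpha> \<beta>) \<and>
       \<bar>int (fact_length r b) - int (fact_length r a)\<bar> \<le> int j}"


section \<open>Hilbert function of a quotient of two ideals\<close>

text \<open>For homogeneous ideals \<open>J \<subseteq> I\<close> of the polynomial ring \<open>R\<close>, the graded module \<open>I/J\<close> is
  an ideal of the ring \<open>R/J\<close>; its part of degree \<open>\<beta>\<close> consists of the cosets of the elements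
  of \<open>I\<close> that are homogeneous of degree \<open>\<beta>\<close>. The base field acts on it through the cosets
  of the constant polynomials, so its dimension is a dimension inside \<open>R/J\<close>.\<close>

definition quotient_part ::
    "nat \<Rightarrow> (nat \<Rightarrow> 'a::comm_monoid_add) \<Rightarrow> 'k::field mvpoly set \<Rightarrow> 'k mvpoly set \<Rightarrow> 'a
      \<Rightarrow> 'k mvpoly set set" where
  "quotient_part r \<alpha> I J \<beta> = {J +>\<^bsub>poly_ring r\<^esub> p | p. p \<in> I \<inter> homogeneous_part r \<alpha> \<beta>}"

definition quotient_scalars :: "nat \<Rightarrow> 'k::field mvpoly set \<Rightarrow> 'k mvpoly set set" where
  "quotient_scalars r J = (\<lambda>c. J +>\<^bsub>poly_ring r\<^esub> Poly_Mapping.single 0 c) ` UNIV"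

definition finite_dim_part ::
    "nat \<Rightarrow> (nat \<Rightarrow> 'a::comm_monoid_add) \<Rightarrow> 'k::field mvpoly set \<Rightarrow> 'k mvpoly set \<Rightarrow> 'a
      \<Rightarrow> bool" where
  "finite_dim_part r \<alpha> I J \<beta> \<longleftrightarrow>
     ring.finite_dimension (poly_ring r Quot J) (quotient_scalars r J) (quotient_part r \<alpha> I J \<beta>)"

definition hilbert_function ::
    "nat \<Rightarrow> (nat \<Rightarrow> 'a::comm_monoid_add) \<Rightarrow> 'k::field mvpoly set \<Rightarrow> 'k mvpoly set \<Rightarrow> 'a
      \<Rightarrow> nat" where
  "hilbert_function r \<alpha> I J \<beta> =
     ring.dim (poly_ring r Quot J) (quotient_scalars r J) (quotient_part r \<alpha> I J \<beta>)"

end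

theory Submission
  imports Defs
begin

text \<open>Write \<open>L\<close> for the length set of \<open>\<beta>\<close>. For a threshold \<open>t\<close>, let \<open>\<phi>\<^sub>t(p)\<close> be the sum of the
coefficients of \<open>p\<close> at the factorizations of \<open>\<beta>\<close> of length at most \<open>t\<close>. A binomial
\<open>y\<^sup>a - y\<^sup>b\<close> of degree \<open>\<beta>\<close> is killed by \<open>\<phi>\<^sub>t\<close> unless \<open>t\<close> separates the lengths of \<open>a\<close> and \<open>b\<close>.
Hence, if \<open>L\<close> has no element in \<open>{t<..t + j}\<close> (\<open>t\<close> is then called a cut for \<open>j\<close>), no generator
of \<open>I\<^sub>j\<close> is seen by \<open>\<phi>\<^sub>t\<close>. The polynomials killed by all these functionals, for all degrees
at once, form an ideal: multiplying by a monomial \<open>y\<^sup>c\<close> shifts degrees and lengths, and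
since the monoid is cancellative it takes cuts back to cuts. So this vanishing ideal contains
\<open>I\<^sub>j\<close> (\<open>length_diff_ideal_subset_vanishing_ideal\<close>). Conversely, a homogeneous polynomial killed by
\<open>\<phi>\<^sub>t\<close> for all cuts \<open>t\<close> in \<open>L\<close> can be reduced to \<open>0\<close> by repeatedly moving the coefficient of a
shortest monomial to another monomial whose length exceeds it by at most \<open>j\<close>
(\<open>in_length_diff_idealI\<close>).

An element \<open>t\<close> of \<open>L\<close> is a cut for \<open>j\<close> but not for \<open>j + 1\<close> exactly when the next element of \<open>L\<close>
is \<open>t + j + 1\<close>. So inside the degree \<open>\<beta>\<close> part of \<open>I\<^bsub>j+1\<^esub>\<close>, the ideal \<open>I\<^sub>j\<close> is the common
kernel of the functionals \<open>\<phi>\<^sub>t\<close>, where \<open>t\<close> runs over the starts of the gaps of size \<open>j + 1\<close>.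
These functionals have a dual family: for each such \<open>t\<close> a binomial \<open>y\<^sup>a - y\<^sup>b\<close> with \<open>a\<close> of
length \<open>t\<close> and \<open>b\<close> of length \<open>t + j + 1\<close>. Therefore the dimension of the quotient is the number of
these gaps (\<open>hilbert_function_length_diff_quotient\<close>), and the ideal grows at step \<open>j + 1\<close> if and
only if such a gap occurs for some \<open>\<beta>\<close> (\<open>length_diff_ideal_psubset_iff\<close>).

The argument applies to every cancellative monoid with finite length sets. Finiteness comes from
minimality and reducedness: a generator is nonzero, hence not torsion, so its \<open>\<nat>\<^sup>d\<close> component
is nonzero and the coordinate sum of \<open>\<beta>\<close> bounds the lengths of its factorizations.\<close>

section \<open>Operations of the polynomial ring\<close>

lemma poly_ring_simps [simp]:
  "p \<otimes>\<^bsub>poly_ring r\<^esub> q = p * q" "p \<oplus>\<^bsub>poly_ring r\<^esub> q = p + q"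
  "\<one>\<^bsub>poly_ring r\<^esub> = 1" "\<zero>\<^bsub>poly_ring r\<^esub> = 0"
  by (auto simp: poly_ring_def)

lemma carrier_poly_ring_iff:
  "p \<in> carrier (poly_ring r) \<longleftrightarrow> (\<forall>a\<in>Poly_Mapping.keys p. Poly_Mapping.keys a \<subseteq> {..<r})"
  by (simp add: poly_ring_def)

lemma keys_uminus [simp]: "Poly_Mapping.keys (- p) = Poly_Mapping.keys (p :: 'a \<Rightarrow>\<^sub>0 'k::ab_group_add)"
  by (auto simp: in_keys_iff)

lemma poly_ring_a_inv [simp]:
  assumes "p \<in> carrier (poly_ring r :: 'k::field mvpoly ring)"
  shows "\<ominus>\<^bsub>poly_ring r\<^esub> p = - p"
proof -
  interpret cring "poly_ring r :: 'k mvpoly ring" by (rule cring_poly_ring)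
  show ?thesis
    using assms by (intro minus_equality) (auto simp: carrier_poly_ring_iff)
qed

lemma poly_ring_a_minus [simp]:
  assumes "q \<in> carrier (poly_ring r :: 'k::field mvpoly ring)"
  shows "p \<ominus>\<^bsub>poly_ring r\<^esub> q = p - q"
  using poly_ring_a_inv[OF assms] by (simp add: a_minus_def)

lemma poly_ring_ideal_closed:
  fixes J :: "'k::field mvpoly set"
  assumes "ideal J (poly_ring r)"
  shows "0 \<in> J" "p \<in> J \<Longrightarrow> q \<in> J \<Longrightarrow> p + q \<in> J" "p \<in> J \<Longrightarrow> q \<in> J \<Longrightarrow> p - q \<in> J"
    "p \<in> J \<Longrightarrow> q \<in> carrier (poly_ring r) \<Longrightarrow> q * p \<in> J"
    "p \<in> J \<Longrightarrow> p \<in> carrier (poly_ring r)"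
proof -
  interpret ideal J "poly_ring r" by fact
  note add = additive_subgroup.a_closed[OF is_additive_subgroup, unfolded poly_ring_simps]
  show "0 \<in> J" using additive_subgroup.zero_closed[OF is_additive_subgroup] by simp
  show "p \<in> J \<Longrightarrow> q \<in> J \<Longrightarrow> p + q \<in> J" by (rule add)
  show carr: "p \<in> J \<Longrightarrow> p \<in> carrier (poly_ring r)" for p using a_subset by blast
  show "p \<in> J \<Longrightarrow> q \<in> J \<Longrightarrow> p - q \<in> J"
    using add[of p "- q"] additive_subgroup.a_inv_closed[OF is_additive_subgroup, of q]
      poly_ring_a_inv[OF carr, of q] by simp
  show "p \<in> J \<Longrightarrow> q \<in> carrier (poly_ring r) \<Longrightarrow> q * p \<in> J"
    using I_l_closed[of p q] by simp
qed

section \<open>Coefficient sums\<close>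

definition coeff_sum :: "'b set \<Rightarrow> ('b \<Rightarrow>\<^sub>0 'k::comm_monoid_add) \<Rightarrow> 'k" where
  "coeff_sum S p = (\<Sum>a\<in>Poly_Mapping.keys p \<inter> S. Poly_Mapping.lookup p a)"

text \<open>The index set \<open>keys p\<close> of the sum varies with \<open>p\<close>; linearity is proved by passing to one finite
index set that serves all polynomials involved.\<close>
lemma coeff_sum_alt:
  assumes "finite F" "Poly_Mapping.keys p \<subseteq> F"
  shows "coeff_sum S p = (\<Sum>a\<in>F. Poly_Mapping.lookup p a when a \<in> S)"
proof -
  have "coeff_sum S p = (\<Sum>a\<in>Poly_Mapping.keys p \<inter> S. Poly_Mapping.lookup p a when a \<in> S)"
    unfolding coeff_sum_def by (rule sum.cong) auto
  also have "\<dots> = (\<Sum>a\<in>F. Poly_Mapping.lookup p a when a \<in> S)"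
    using assms by (intro sum.mono_neutral_left) (auto simp: in_keys_iff when_def)
  finally show ?thesis .
qed

lemma coeff_sum_0 [simp]: "coeff_sum S 0 = 0"
  by (simp add: coeff_sum_def)

lemma coeff_sum_add [simp]: "coeff_sum S (p + q) = coeff_sum S p + coeff_sum S q"
  using Poly_Mapping.keys_add[of p q]
  by (simp add: coeff_sum_alt[where F = "Poly_Mapping.keys p \<union> Poly_Mapping.keys q"]
      lookup_add when_add_distrib sum.distrib)

lemma coeff_sum_uminus [simp]:
  "coeff_sum S (- p) = - coeff_sum S (p :: 'a \<Rightarrow>\<^sub>0 'k::ab_group_add)"
  by (simp add: coeff_sum_def sum_negf)

lemma coeff_sum_diff [simp]:
  "coeff_sum S (p - q) = coeff_sum S p - coeff_sum S (q :: 'a \<Rightarrow>\<^sub>0 'k::ab_group_add)"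
  using coeff_sum_add[of S p "- q"] by (simp del: coeff_sum_add)

lemma coeff_sum_sum: "coeff_sum S (\<Sum>i\<in>A. f i) = (\<Sum>i\<in>A. coeff_sum S (f i))"
  by (induction A rule: infinite_finite_induct) auto

lemma coeff_sum_single [simp]:
  "coeff_sum S (Poly_Mapping.single a c) = (if a \<in> S then c else 0)"
  by (auto simp: coeff_sum_def)

lemma sum_single_lookup:
  "(\<Sum>a\<in>Poly_Mapping.keys p. Poly_Mapping.single a (Poly_Mapping.lookup p a)) = p"
  by (rule poly_mapping_eqI)
    (auto simp: lookup_sum lookup_single when_def sum.delta in_keys_iff)

lemma coeff_sum_single_mult:
  fixes p :: "'b::monoid_add \<Rightarrow>\<^sub>0 'k::semiring_0"
  shows "coeff_sum S (Poly_Mapping.single c k * p) = k * coeff_sum {a. c + a \<in> S} p"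
proof -
  have "Poly_Mapping.single c k * p =
      (\<Sum>a\<in>Poly_Mapping.keys p. Poly_Mapping.single (c + a) (k * Poly_Mapping.lookup p a))"
    by (subst (1) sum_single_lookup[of p, symmetric]) (simp add: sum_distrib_left mult_single)
  then show ?thesis
    by (simp add: coeff_sum_sum coeff_sum_alt[of "Poly_Mapping.keys p" p] sum_distrib_left
        when_def if_distrib cong: if_cong)
qed

lemma coeff_sum_const_mult [simp]:
  "coeff_sum S (Poly_Mapping.single 0 k * p) =
    k * coeff_sum S (p :: 'b::monoid_add \<Rightarrow>\<^sub>0 'k::semiring_0)"
  by (simp add: coeff_sum_single_mult)

text \<open>To test a product against a functional it suffices to test the monomial multiples of one
factor; this turns closure of a common kernel under multiplication into a statement about shifts.\<close>
lemma coeff_sum_mult_eq_0: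
  fixes p :: "'b::monoid_add \<Rightarrow>\<^sub>0 'k::semiring_0"
  assumes "\<And>c. c \<in> Poly_Mapping.keys q \<Longrightarrow> coeff_sum {a. c + a \<in> S} p = 0"
  shows "coeff_sum S (q * p) = 0"
proof -
  have "q * p = (\<Sum>c\<in>Poly_Mapping.keys q.
      Poly_Mapping.single c (Poly_Mapping.lookup q c) * p)"
    by (simp add: sum_single_lookup flip: sum_distrib_right)
  then show ?thesis
    using assms by (simp add: coeff_sum_sum coeff_sum_single_mult)
qed

section \<open>Factorizations\<close>

lemma nat_scale_simps [simp]: "nat_scale 0 x = 0" "nat_scale (Suc n) x = nat_scale n x + x"
  by (simp_all add: nat_scale_def)

lemma nat_scale_add: "nat_scale (m + n) x = nat_scale m x + nat_scale n x"
  by (induction n) (simp_all add: add.assoc)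

lemma fact_length_add [simp]: "fact_length r (a + b) = fact_length r a + fact_length r b"
  by (simp add: fact_length_def lookup_add sum.distrib)

lemma zero_in_factorizations: "0 \<in> factorizations r \<alpha> 0"
  by (simp add: factorizations_def)

lemma fact_length_0 [simp]: "fact_length r 0 = 0"
  by (simp add: fact_length_def)

lemma fact_length_in_length_set:
  "a \<in> factorizations r \<alpha> \<beta> \<Longrightarrow> fact_length r a \<in> length_set r \<alpha> \<beta>"
  by (simp add: length_set_def)

lemma factorizations_unique:
  "a \<in> factorizations r \<alpha> \<beta> \<Longrightarrow> a \<in> factorizations r \<alpha> \<gamma> \<Longrightarrow> \<beta> = \<gamma>"
  by (auto simp: factorizations_def)

lemma factorizations_add:
  assumes "a \<in> factorizations r \<alpha> \<beta>" "b \<in> factorizations r \<alpha> \<gamma>"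
  shows "a + b \<in> factorizations r \<alpha> (\<beta> + \<gamma>)"
  using assms Poly_Mapping.keys_add[of a b]
  by (auto simp: factorizations_def lookup_add nat_scale_add sum.distrib)

lemma ex_factorizations:
  assumes "Poly_Mapping.keys a \<subseteq> {..<r}"
  shows "\<exists>\<beta>. a \<in> factorizations r \<alpha> \<beta>"
  using assms by (simp add: factorizations_def)

text \<open>This is where cancellation enters: a shift by \<open>c\<close> sends factorizations of only one
element to factorizations of \<open>\<gamma> + \<beta>\<close>.\<close>
lemma factorizations_add_cancel:
  fixes \<alpha> :: "nat \<Rightarrow> 'a::cancel_comm_monoid_add"
  assumes "c \<in> factorizations r \<alpha> \<gamma>" "Poly_Mapping.keys a \<subseteq> {..<r}"
  shows "c + a \<in> factorizations r \<alpha> (\<gamma> + \<beta>) \<longleftrightarrow> a \<in> factorizations r \<alpha> \<beta>"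
proof
  obtain \<delta> where \<delta>: "a \<in> factorizations r \<alpha> \<delta>" using ex_factorizations[OF assms(2)] by blast
  assume "c + a \<in> factorizations r \<alpha> (\<gamma> + \<beta>)"
  then have "\<gamma> + \<beta> = \<gamma> + \<delta>"
    using factorizations_add[OF assms(1) \<delta>] by (rule factorizations_unique)
  then show "a \<in> factorizations r \<alpha> \<beta>" using \<delta> by simp
qed (rule factorizations_add[OF assms(1)])

section \<open>Length difference ideals as kernels of coefficient sums\<close>

definition short_factorizations ::
    "nat \<Rightarrow> (nat \<Rightarrow> 'a::comm_monoid_add) \<Rightarrow> 'a \<Rightarrow> nat \<Rightarrow> (nat \<Rightarrow>\<^sub>0 nat) set" where
  "short_factorizations r \<alpha> \<beta> t = {a \<in> factorizations r \<alpha> \<beta>. fact_length r a \<le> t}"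

text \<open>A cut need not be a length itself. Allowing arbitrary thresholds is what makes cuts stable under the
shift \<open>t \<mapsto> t - |c|\<close> that multiplication by \<open>y\<^sup>c\<close> induces.\<close>
definition cut :: "nat \<Rightarrow> (nat \<Rightarrow> 'a::comm_monoid_add) \<Rightarrow> 'a \<Rightarrow> nat \<Rightarrow> nat \<Rightarrow> bool" where
  "cut r \<alpha> \<beta> j t \<longleftrightarrow> length_set r \<alpha> \<beta> \<inter> {t<..t + j} = {}"

definition vanishing_ideal ::
    "nat \<Rightarrow> (nat \<Rightarrow> 'a::comm_monoid_add) \<Rightarrow> nat \<Rightarrow> 'k::field mvpoly set" where
  "vanishing_ideal r \<alpha> j = {p \<in> carrier (poly_ring r).
     \<forall>\<beta> t. cut r \<alpha> \<beta> j t \<longrightarrow> coeff_sum (short_factorizations r \<alpha> \<beta> t) p = 0}"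

text \<open>The functional of degree \<open>\<beta>\<close> and threshold \<open>t\<close>, applied to \<open>y\<^sup>c p\<close>, only sees the monomials
\<open>y\<^sup>a\<close> of \<open>p\<close> with \<open>c + a\<close> a factorization of \<open>\<beta>\<close>. By cancellation these \<open>a\<close> all factor one
element \<open>\<delta>\<close>, so it is the functional of degree \<open>\<delta>\<close> and threshold \<open>t - |c|\<close>. The new threshold
is again a cut, because a length of \<open>\<delta>\<close> in the forbidden range would give a length of \<open>\<beta>\<close>
in the forbidden range for \<open>t\<close> by adding \<open>|c|\<close>.\<close>
lemma coeff_sum_shift:
  fixes \<alpha> :: "nat \<Rightarrow> 'a::cancel_comm_monoid_add" and p :: "'k::field mvpoly"
  assumes p: "p \<in> vanishing_ideal r \<alpha> j" and c: "Poly_Mapping.keys c \<subseteq> {..<r}"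
    and t: "cut r \<alpha> \<beta> j t"
  shows "coeff_sum {a. c + a \<in> short_factorizations r \<alpha> \<beta> t} p = 0"
proof (cases "\<exists>a\<in>Poly_Mapping.keys p. c + a \<in> short_factorizations r \<alpha> \<beta> t")
  case False
  then have "Poly_Mapping.keys p \<inter> {a. c + a \<in> short_factorizations r \<alpha> \<beta> t} = {}" by blast
  then show ?thesis by (simp add: coeff_sum_def)
next
  case True
  then obtain a where a: "a \<in> Poly_Mapping.keys p" "c + a \<in> factorizations r \<alpha> \<beta>"
    "fact_length r (c + a) \<le> t"
    by (auto simp: short_factorizations_def)
  have pcarr: "Poly_Mapping.keys b \<subseteq> {..<r}" if "b \<in> Poly_Mapping.keys p" for b
    using p that by (auto simp: vanishing_ideal_def carrier_poly_ring_iff)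
  obtain \<gamma> where \<gamma>: "c \<in> factorizations r \<alpha> \<gamma>" using ex_factorizations[OF c] by blast
  obtain \<delta> where \<delta>: "a \<in> factorizations r \<alpha> \<delta>" using ex_factorizations[OF pcarr[OF a(1)]] by blast
  have \<beta>: "\<beta> = \<gamma> + \<delta>"
    using factorizations_unique[OF a(2) factorizations_add[OF \<gamma> \<delta>]] .
  define s where "s = t - fact_length r c"
  have ts: "t = fact_length r c + s" using a(3) by (simp add: s_def)
  have shift: "c + b \<in> short_factorizations r \<alpha> \<beta> t \<longleftrightarrow> b \<in> short_factorizations r \<alpha> \<delta> s"
    if "Poly_Mapping.keys b \<subseteq> {..<r}" for b
    using factorizations_add_cancel[OF \<gamma> that, of \<delta>]
    by (simp add: short_factorizations_def \<beta> ts)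
  have "cut r \<alpha> \<delta> j s"
    unfolding cut_def
  proof (rule ccontr)
    assume "length_set r \<alpha> \<delta> \<inter> {s<..s + j} \<noteq> {}"
    then obtain b where b: "b \<in> factorizations r \<alpha> \<delta>" "s < fact_length r b" "fact_length r b \<le> s + j"
      by (auto simp: length_set_def)
    have "fact_length r (c + b) \<in> length_set r \<alpha> \<beta> \<inter> {t<..t + j}"
      using b fact_length_in_length_set[OF factorizations_add[OF \<gamma> b(1)]] by (simp add: \<beta> ts)
    then show False using t by (auto simp: cut_def)
  qed
  then have "coeff_sum (short_factorizations r \<alpha> \<delta> s) p = 0"
    using p by (auto simp: vanishing_ideal_def)
  moreover have "Poly_Mapping.keys p \<inter> {a. c + a \<in> short_factorizations r \<alpha> \<beta> t} =
      Poly_Mapping.keys p \<inter> short_factorizations r \<alpha> \<delta> s"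
    using shift pcarr by blast
  ultimately show ?thesis by (simp add: coeff_sum_def)
qed

text \<open>The kernel of a single functional need not be an ideal; the intersection over all degrees and all cuts
is one, since monomial multiplication carries each of these conditions to another one, or to a trivial one.\<close>
lemma ideal_vanishing_ideal:
  fixes \<alpha> :: "nat \<Rightarrow> 'a::cancel_comm_monoid_add"
  shows "ideal (vanishing_ideal r \<alpha> j :: 'k::field mvpoly set) (poly_ring r)" (is "ideal ?V _")
proof -
  interpret cring "poly_ring r :: 'k mvpoly ring" by (rule cring_poly_ring)
  have mult: "q * p \<in> ?V" if p: "p \<in> ?V" and q: "q \<in> carrier (poly_ring r)" for p q
  proof -
    have "q * p \<in> carrier (poly_ring r)"
      using m_closed[of q p] p q unfolding poly_ring_simps by (simp add: vanishing_ideal_def)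
    moreover have "coeff_sum (short_factorizations r \<alpha> \<beta> t) (q * p) = 0" if "cut r \<alpha> \<beta> j t" for \<beta> t
      using q by (intro coeff_sum_mult_eq_0 coeff_sum_shift[OF p _ that]) (auto simp: carrier_poly_ring_iff)
    ultimately show ?thesis by (simp add: vanishing_ideal_def)
  qed
  show ?thesis
  proof (rule idealI[OF ring_axioms])
    show "subgroup ?V (add_monoid (poly_ring r))"
    proof (rule add.subgroupI)
      fix p q :: "'k mvpoly" assume pq: "p \<in> ?V" "q \<in> ?V"
      then show "p \<oplus>\<^bsub>poly_ring r\<^esub> q \<in> ?V"
        using add.m_closed[of p q] unfolding poly_ring_simps by (auto simp: vanishing_ideal_def)
      have carr: "p \<in> carrier (poly_ring r)" using pq(1) unfolding vanishing_ideal_def by blast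
      show "\<ominus>\<^bsub>poly_ring r\<^esub> p \<in> ?V"
        unfolding poly_ring_a_inv[OF carr] using pq(1) by (simp add: vanishing_ideal_def carrier_poly_ring_iff)
    next
      have "0 \<in> ?V" by (simp add: vanishing_ideal_def carrier_poly_ring_iff)
      then show "?V \<noteq> {}" by blast
    qed (auto simp: vanishing_ideal_def)
  qed (use mult in \<open>auto simp: mult.commute\<close>)
qed


lemma monomial_in_carrier:
  "a \<in> factorizations r \<alpha> \<beta> \<Longrightarrow> Poly_Mapping.single a k \<in> carrier (poly_ring r)"
  by (auto simp: carrier_poly_ring_iff factorizations_def)

lemma poly_ring_diff_closed:
  fixes p :: "'k::field mvpoly"
  assumes "p \<in> carrier (poly_ring r)" "q \<in> carrier (poly_ring r)"
  shows "p - q \<in> carrier (poly_ring r)"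
proof -
  interpret cring "poly_ring r :: 'k mvpoly ring" by (rule cring_poly_ring)
  show ?thesis using minus_closed[OF assms] poly_ring_a_minus[OF assms(2), of p] by simp
qed

lemma length_diff_generators_subset_carrier:
  "{monomial a - monomial b | a b.
       (\<exists>\<beta>\<in>G. a \<in> factorizations r \<alpha> \<beta> \<and> b \<in> factorizations r \<alpha> \<beta>) \<and>
       \<bar>int (fact_length r b) - int (fact_length r a)\<bar> \<le> int j}
    \<subseteq> carrier (poly_ring r :: 'k::field mvpoly ring)"
  using poly_ring_diff_closed[OF monomial_in_carrier monomial_in_carrier] by blast

lemma ideal_length_diff_ideal:
  "ideal (length_diff_ideal G r \<alpha> j :: 'k::field mvpoly set) (poly_ring r)"
proof -
  interpret cring "poly_ring r :: 'k mvpoly ring" by (rule cring_poly_ring)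
  show ?thesis
    unfolding length_diff_ideal_def
    by (rule genideal_ideal[OF length_diff_generators_subset_carrier])
qed

lemma binomial_in_length_diff_ideal:
  assumes "\<beta> \<in> G" "a \<in> factorizations r \<alpha> \<beta>" "b \<in> factorizations r \<alpha> \<beta>"
    and "fact_length r a \<le> fact_length r b + j" "fact_length r b \<le> fact_length r a + j"
  shows "monomial a - monomial b \<in> (length_diff_ideal G r \<alpha> j :: 'k::field mvpoly set)"
proof -
  interpret cring "poly_ring r :: 'k mvpoly ring" by (rule cring_poly_ring)
  have len: "\<bar>int (fact_length r b) - int (fact_length r a)\<bar> \<le> int j"
    using assms(4,5) by linarith
  show ?thesis
    unfolding length_diff_ideal_def
    using assms(1-3)
    by (intro subsetD[OF genideal_self[OF length_diff_generators_subset_carrier]] CollectI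
        exI[of _ a] exI[of _ b] conjI refl bexI[of _ \<beta>] len)
qed

lemma length_diff_ideal_subsetI:
  fixes J :: "'k::field mvpoly set"
  assumes "ideal J (poly_ring r)"
    and "\<And>a b \<beta>. \<beta> \<in> G \<Longrightarrow> a \<in> factorizations r \<alpha> \<beta> \<Longrightarrow> b \<in> factorizations r \<alpha> \<beta> \<Longrightarrow>
      fact_length r a \<le> fact_length r b + j \<Longrightarrow> fact_length r b \<le> fact_length r a + j \<Longrightarrow>
      monomial a - monomial b \<in> J"
  shows "length_diff_ideal G r \<alpha> j \<subseteq> J"
proof -
  interpret cring "poly_ring r :: 'k mvpoly ring" by (rule cring_poly_ring)
  show ?thesis
    unfolding length_diff_ideal_def
  proof (rule genideal_minimal[OF assms(1)], rule subsetI)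
    fix x :: "'k mvpoly"
    assume "x \<in> {monomial a - monomial b | a b.
       (\<exists>\<beta>\<in>G. a \<in> factorizations r \<alpha> \<beta> \<and> b \<in> factorizations r \<alpha> \<beta>) \<and>
       \<bar>int (fact_length r b) - int (fact_length r a)\<bar> \<le> int j}"
    then obtain a b \<beta> where x: "x = monomial a - monomial b"
      and ab: "\<beta> \<in> G" "a \<in> factorizations r \<alpha> \<beta>" "b \<in> factorizations r \<alpha> \<beta>"
      and len: "\<bar>int (fact_length r b) - int (fact_length r a)\<bar> \<le> int j"
      by blast
    show "x \<in> J" unfolding x using len by (intro assms(2)[OF ab]) linarith+
  qed
qed

lemma length_diff_ideal_mono:
  "i \<le> j \<Longrightarrow> length_diff_ideal G r \<alpha> i \<subseteq> (length_diff_ideal G r \<alpha> j :: 'k::field mvpoly set)"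
  by (intro length_diff_ideal_subsetI ideal_length_diff_ideal binomial_in_length_diff_ideal) auto

lemma length_set_ideal_eq:
  "length_set_ideal G r \<alpha> = (length_diff_ideal G r \<alpha> 0 :: 'k::field mvpoly set)"
proof -
  have "\<bar>int m - int n\<bar> \<le> int 0 \<longleftrightarrow> n = m" for m n by auto
  then show ?thesis unfolding length_set_ideal_def length_diff_ideal_def by presburger
qed

text \<open>A cut for \<open>j\<close> cannot separate two lengths of the same element that differ by at most \<open>j\<close>: the
larger one would lie in \<open>{t<..t + j}\<close>. So the two coefficients \<open>1\<close> and \<open>- 1\<close> of a generator are
either both counted or both ignored.\<close>
lemma length_diff_ideal_subset_vanishing_ideal:
  fixes \<alpha> :: "nat \<Rightarrow> 'a::cancel_comm_monoid_add"
  shows "length_diff_ideal G r \<alpha> j \<subseteq> (vanishing_ideal r \<alpha> j :: 'k::field mvpoly set)"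
proof (rule length_diff_ideal_subsetI[OF ideal_vanishing_ideal])
  fix a b \<beta>
  assume ab: "a \<in> factorizations r \<alpha> \<beta>" "b \<in> factorizations r \<alpha> \<beta>"
    and len: "fact_length r a \<le> fact_length r b + j" "fact_length r b \<le> fact_length r a + j"
  have "a \<in> short_factorizations r \<alpha> \<gamma> t \<longleftrightarrow> b \<in> short_factorizations r \<alpha> \<gamma> t"
    if "cut r \<alpha> \<gamma> j t" for \<gamma> t
  proof (cases "\<gamma> = \<beta>")
    case True
    have "fact_length r c \<le> t \<or> t + j < fact_length r c" if "c \<in> factorizations r \<alpha> \<beta>" for c
      using \<open>cut r \<alpha> \<gamma> j t\<close> fact_length_in_length_set[OF that] by (auto simp: True cut_def)
    from this[OF ab(1)] this[OF ab(2)] show ?thesis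
      using ab len True by (auto simp: short_factorizations_def)
  next
    case False
    then show ?thesis
      using factorizations_unique[OF ab(1), of \<gamma>] factorizations_unique[OF ab(2), of \<gamma>]
      by (auto simp: short_factorizations_def)
  qed
  moreover have "monomial a - monomial b \<in> carrier (poly_ring r :: 'k mvpoly ring)"
    using ab by (intro poly_ring_diff_closed monomial_in_carrier)
  ultimately show "monomial a - monomial b \<in> (vanishing_ideal r \<alpha> j :: 'k mvpoly set)"
    by (simp add: vanishing_ideal_def)
qed

lemma coeff_sum_length_diff_ideal:
  fixes \<alpha> :: "nat \<Rightarrow> 'a::cancel_comm_monoid_add"
  assumes "p \<in> length_diff_ideal G r \<alpha> j" "cut r \<alpha> \<beta> j t"
  shows "coeff_sum (short_factorizations r \<alpha> \<beta> t) (p :: 'k::field mvpoly) = 0"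
  using subsetD[OF length_diff_ideal_subset_vanishing_ideal assms(1)] assms(2)
  by (simp add: vanishing_ideal_def)

text \<open>The step of the reduction to \<open>0\<close>, for a shortest monomial \<open>a\<close> of \<open>p\<close>. If its length is not a cut,
some strictly longer factorization is within reach. If it is a cut, the corresponding functional sums
exactly the coefficients at the monomials of minimal length; as it vanishes, \<open>a\<close> is not the only
one of them. The last property ensures that the support either shrinks or moves to longer monomials.\<close>
lemma ex_reducing_factorization:
  fixes p :: "'k::field mvpoly"
  assumes p: "p \<in> homogeneous_part r \<alpha> \<beta>"
    and vanish: "\<And>t. t \<in> length_set r \<alpha> \<beta> \<Longrightarrow> cut r \<alpha> \<beta> j t \<Longrightarrow>
      coeff_sum (short_factorizations r \<alpha> \<beta> t) p = 0"
    and a: "a \<in> Poly_Mapping.keys p"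
      "\<And>b. b \<in> Poly_Mapping.keys p \<Longrightarrow> fact_length r a \<le> fact_length r b"
  obtains c where "c \<in> factorizations r \<alpha> \<beta>" "c \<noteq> a"
    "fact_length r a \<le> fact_length r c" "fact_length r c \<le> fact_length r a + j"
    "c \<in> Poly_Mapping.keys p \<or> fact_length r a < fact_length r c"
proof (cases "cut r \<alpha> \<beta> j (fact_length r a)")
  case False
  then obtain c where "c \<in> factorizations r \<alpha> \<beta>"
    "fact_length r a < fact_length r c" "fact_length r c \<le> fact_length r a + j"
    by (auto simp: cut_def length_set_def)
  then show ?thesis by (intro that[of c]) auto
next
  case True
  have aZ: "a \<in> factorizations r \<alpha> \<beta>" using p a by (auto simp: homogeneous_part_def)
  have "\<exists>c\<in>Poly_Mapping.keys p. c \<noteq> a \<and> fact_length r c \<le> fact_length r a"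
  proof (rule ccontr)
    assume "\<not> ?thesis"
    then have "Poly_Mapping.keys p \<inter> short_factorizations r \<alpha> \<beta> (fact_length r a) = {a}"
      using a(1) aZ by (auto simp: short_factorizations_def)
    then have "Poly_Mapping.lookup p a = 0"
      using vanish[OF fact_length_in_length_set[OF aZ] True] by (simp add: coeff_sum_def)
    then show False using a(1) by (simp add: in_keys_iff)
  qed
  then obtain c where c: "c \<in> Poly_Mapping.keys p" "c \<noteq> a" "fact_length r c \<le> fact_length r a"
    by blast
  show ?thesis
    by (rule that[of c]) (use c p a(2) in \<open>auto simp: homogeneous_part_def\<close>)
qed

text \<open>Subtracting \<open>k (y\<^sup>a - y\<^sup>c)\<close>, with \<open>k\<close> the coefficient at a shortest monomial \<open>a\<close>, stays in the
same class modulo \<open>I\<^sub>j\<close> and keeps the functionals zero, so it can be iterated. Termination: give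
a monomial the weight \<open>W + 1 - |a|\<close>, where \<open>W\<close> bounds all lengths. Weights are positive and
decrease with the length, so the total weight of the support drops whether \<open>a\<close> merely disappears or
is replaced by a longer \<open>c\<close>.\<close>
lemma in_length_diff_idealI:
  fixes \<alpha> :: "nat \<Rightarrow> 'a::cancel_comm_monoid_add" and p :: "'k::field mvpoly"
  assumes "\<beta> \<in> G" and fin: "finite (length_set r \<alpha> \<beta>)"
    and "p \<in> homogeneous_part r \<alpha> \<beta>"
    and "\<And>t. t \<in> length_set r \<alpha> \<beta> \<Longrightarrow> cut r \<alpha> \<beta> j t \<Longrightarrow>
      coeff_sum (short_factorizations r \<alpha> \<beta> t) p = 0"
  shows "p \<in> length_diff_ideal G r \<alpha> j"
proof -
  obtain W where W: "\<And>l. l \<in> length_set r \<alpha> \<beta> \<Longrightarrow> l \<le> W"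
    using fin by (meson finite_nat_set_iff_bounded_le)
  define w where "w a = Suc W - fact_length r a" for a
  define \<mu> where "\<mu> q = (\<Sum>a\<in>Poly_Mapping.keys q. w a)" for q :: "'k mvpoly"
  note I = poly_ring_ideal_closed[OF ideal_length_diff_ideal[of G r \<alpha> j]]
  show ?thesis using assms(3,4)
  proof (induction "\<mu> p" arbitrary: p rule: less_induct)
    case less
    show ?case
    proof (cases "p = 0")
      case True
      then show ?thesis using I(1) by simp
    next
      case False
      then have "Poly_Mapping.keys p \<noteq> {}" by simp
      then obtain a where a: "a \<in> Poly_Mapping.keys p"
        and a_min: "\<And>b. b \<in> Poly_Mapping.keys p \<Longrightarrow> fact_length r a \<le> fact_length r b"
        using ex_min_if_finite[of "fact_length r ` Poly_Mapping.keys p"] by fastforce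
      obtain c where c: "c \<in> factorizations r \<alpha> \<beta>" "c \<noteq> a"
          "fact_length r a \<le> fact_length r c" "fact_length r c \<le> fact_length r a + j"
          "c \<in> Poly_Mapping.keys p \<or> fact_length r a < fact_length r c"
        using ex_reducing_factorization[OF less.prems a a_min] by blast
      have aZ: "a \<in> factorizations r \<alpha> \<beta>" using less.prems(1) a by (auto simp: homogeneous_part_def)
      define k where "k = Poly_Mapping.lookup p a"
      define g where "g = Poly_Mapping.single 0 k * (monomial a - monomial c :: 'k mvpoly)"
      have g: "g = Poly_Mapping.single a k - Poly_Mapping.single c k"
        by (simp add: g_def right_diff_distrib mult_single)
      have "(monomial a - monomial c :: 'k mvpoly) \<in> length_diff_ideal G r \<alpha> j"
        using c by (intro binomial_in_length_diff_ideal[OF \<open>\<beta> \<in> G\<close> aZ]) auto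
      then have gI: "g \<in> length_diff_ideal G r \<alpha> j"
        unfolding g_def by (rule I(4)) (auto simp: carrier_poly_ring_iff)
      define K where "K = insert c (Poly_Mapping.keys p - {a})"
      have keys: "Poly_Mapping.keys (p - g) \<subseteq> K"
        unfolding g K_def k_def
        by (auto simp: in_keys_iff lookup_minus lookup_single when_def split: if_splits)
      have wa: "0 < w a" using W[OF fact_length_in_length_set[OF aZ]] by (simp add: w_def)
      have "\<mu> (p - g) \<le> (\<Sum>b\<in>K. w b)"
        unfolding \<mu>_def by (rule sum_mono2[OF _ keys]) (auto simp: K_def)
      also have "\<dots> < (\<Sum>b\<in>Poly_Mapping.keys p. w b)"
      proof (cases "c \<in> Poly_Mapping.keys p")
        case True
        then have "K = Poly_Mapping.keys p - {a}" using c(2) by (auto simp: K_def)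
        then show ?thesis using wa by (simp add: sum.remove[OF _ a])
      next
        case False
        then have "w c < w a" using c(5) wa by (auto simp: w_def)
        then show ?thesis using False by (simp add: K_def sum.remove[OF _ a])
      qed
      finally have "\<mu> (p - g) < \<mu> p" by (simp add: \<mu>_def)
      moreover have "p - g \<in> homogeneous_part r \<alpha> \<beta>"
        using less.prems(1) keys c(1) by (auto simp: homogeneous_part_def K_def)
      moreover have "coeff_sum (short_factorizations r \<alpha> \<beta> t) (p - g) = 0"
        if "t \<in> length_set r \<alpha> \<beta>" "cut r \<alpha> \<beta> j t" for t
        using less.prems(2)[OF that] coeff_sum_length_diff_ideal[OF gI that(2)] by simp
      ultimately have "p - g \<in> length_diff_ideal G r \<alpha> j" by (rule less.hyps)
      from I(2)[OF this gI] show ?thesis by simp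
    qed
  qed
qed

section \<open>Gaps of length sets\<close>

definition gap_starts ::
    "nat \<Rightarrow> (nat \<Rightarrow> 'a::comm_monoid_add) \<Rightarrow> 'a \<Rightarrow> nat \<Rightarrow> nat set" where
  "gap_starts r \<alpha> \<beta> j =
     {t \<in> length_set r \<alpha> \<beta>. t + j \<in> length_set r \<alpha> \<beta> \<and> length_set r \<alpha> \<beta> \<inter> {t<..<t + j} = {}}"

text \<open>Passing from \<open>j\<close> to \<open>j + 1\<close> forbids just one more value, \<open>t + j + 1\<close>; a cut is lost when that value
is a length, which is then the successor of \<open>t\<close>.\<close>
lemma cut_iff_Suc:
  assumes "t \<in> length_set r \<alpha> \<beta>"
  shows "cut r \<alpha> \<beta> j t \<longleftrightarrow> cut r \<alpha> \<beta> (Suc j) t \<or> t \<in> gap_starts r \<alpha> \<beta> (Suc j)"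
proof -
  have "{t<..t + Suc j} = insert (t + Suc j) {t<..t + j}" "{t<..<t + Suc j} = {t<..t + j}"
    by auto
  then show ?thesis using assms by (auto simp: cut_def gap_starts_def)
qed

text \<open>Gaps may be counted by their lower end instead of by their position in the increasing enumeration.
For \<open>j = 0\<close> this fails: no two consecutive entries agree, but every length \<open>t\<close> satisfies the
conditions defining a gap start.\<close>
lemma bij_betw_gap_indices_gap_starts:
  assumes fin: "finite (length_set r \<alpha> \<beta>)" and "0 < j"
  shows "bij_betw (\<lambda>i. sorted_list_of_set (length_set r \<alpha> \<beta>) ! i)
    (gap_indices r \<alpha> \<beta> j) (gap_starts r \<alpha> \<beta> j)"
proof -
  define L where "L = length_set r \<alpha> \<beta>"
  define ls where "ls = sorted_list_of_set L"
  have set: "set ls = L" and dist: "distinct ls" using fin by (simp_all add: ls_def L_def)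
  have mono: "ls ! i < ls ! k \<longleftrightarrow> i < k" if "i < length ls" "k < length ls" for i k
    using that sorted_wrt_nth_less[OF strict_sorted_list_of_set[of L], folded ls_def]
    by (metis less_asym linorder_neqE_nat)
  have gaps: "gap_indices r \<alpha> \<beta> j = {i. Suc i < length ls \<and> ls ! Suc i = ls ! i + j}"
    using mono \<open>0 < j\<close> unfolding gap_indices_def Let_def L_def[symmetric] ls_def[symmetric]
    by force
  have starts: "gap_starts r \<alpha> \<beta> j = (\<lambda>i. ls ! i) ` {i. Suc i < length ls \<and> ls ! Suc i = ls ! i + j}"
  proof (intro equalityI subsetI)
    fix t assume t: "t \<in> gap_starts r \<alpha> \<beta> j"
    then obtain i k where ik: "i < length ls" "ls ! i = t" "k < length ls" "ls ! k = t + j"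
      unfolding gap_starts_def L_def[symmetric] set[symmetric] in_set_conv_nth by blast
    then have "i < k" using mono[of i k] \<open>0 < j\<close> by simp
    moreover have "\<not> Suc i < k"
    proof
      assume "Suc i < k"
      then have "ls ! Suc i \<in> L \<inter> {t<..<t + j}"
        using ik mono[of i "Suc i"] mono[of "Suc i" k] nth_mem[of "Suc i" ls] set by auto
      then show False using t by (auto simp: gap_starts_def L_def)
    qed
    ultimately have "k = Suc i" by simp
    then show "t \<in> (\<lambda>i. ls ! i) ` {i. Suc i < length ls \<and> ls ! Suc i = ls ! i + j}"
      using ik by (intro image_eqI[of _ _ i]) auto
  next
    fix t assume "t \<in> (\<lambda>i. ls ! i) ` {i. Suc i < length ls \<and> ls ! Suc i = ls ! i + j}"
    then obtain i where i: "Suc i < length ls" "ls ! Suc i = ls ! i + j" "t = ls ! i" by blast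
    have "l \<notin> {t<..<t + j}" if "l \<in> L" for l
    proof -
      obtain k where "k < length ls" "ls ! k = l"
        using \<open>l \<in> L\<close> unfolding set[symmetric] in_set_conv_nth by blast
      then show ?thesis using mono[of i k] mono[of k "Suc i"] i by auto
    qed
    moreover have "t \<in> L" "t + j \<in> L"
      using i nth_mem[of i ls] nth_mem[of "Suc i" ls] set by auto
    ultimately show "t \<in> gap_starts r \<alpha> \<beta> j" by (auto simp: gap_starts_def L_def)
  qed
  have "inj_on (\<lambda>i. ls ! i) {i. Suc i < length ls \<and> ls ! Suc i = ls ! i + j}"
    using dist by (auto simp: inj_on_def nth_eq_iff_index_eq)
  then show ?thesis
    unfolding gaps starts L_def[symmetric] ls_def[symmetric] bij_betw_def by simp
qed

lemma delta_set_iff_gap_starts: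
  assumes "finite (length_set r \<alpha> \<beta>)" and "0 < j"
  shows "j \<in> delta_set r \<alpha> \<beta> \<longleftrightarrow> gap_starts r \<alpha> \<beta> j \<noteq> {}"
proof -
  have "j \<in> delta_set r \<alpha> \<beta> \<longleftrightarrow> gap_indices r \<alpha> \<beta> j \<noteq> {}"
    by (auto simp: delta_set_def gap_indices_def Let_def)
  also have "\<dots> \<longleftrightarrow> gap_starts r \<alpha> \<beta> j \<noteq> {}"
    using bij_betw_gap_indices_gap_starts[OF assms] by (auto simp: bij_betw_def)
  finally show ?thesis .
qed


section \<open>Dimensions of quotients\<close>

lemma quotient_coset_eq_iff:
  fixes J :: "'k::field mvpoly set"
  assumes "ideal J (poly_ring r)" "p \<in> carrier (poly_ring r)" "q \<in> carrier (poly_ring r)"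
  shows "J +>\<^bsub>poly_ring r\<^esub> p = J +>\<^bsub>poly_ring r\<^esub> q \<longleftrightarrow> p - q \<in> J"
proof -
  interpret cring "poly_ring r :: 'k mvpoly ring" by (rule cring_poly_ring)
  show ?thesis
    using quotient_eq_iff_same_a_r_cos[OF assms] poly_ring_a_minus[OF assms(3), of p] by simp
qed

lemma quotient_zero:
  fixes J :: "'k::field mvpoly set"
  assumes J: "ideal J (poly_ring r)"
  shows "\<zero>\<^bsub>poly_ring r Quot J\<^esub> = J +>\<^bsub>poly_ring r\<^esub> 0"
proof -
  interpret ideal J "poly_ring r" by (rule J)
  show ?thesis
    using a_coset_add_zero[OF a_subset] by (simp add: FactRing_def)
qed

lemma quotient_ops:
  fixes J :: "'k::field mvpoly set"
  assumes J: "ideal J (poly_ring r)"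
    and pq: "p \<in> carrier (poly_ring r)" "q \<in> carrier (poly_ring r)"
  shows "J +>\<^bsub>poly_ring r\<^esub> (p * q) =
      (J +>\<^bsub>poly_ring r\<^esub> p) \<otimes>\<^bsub>poly_ring r Quot J\<^esub> (J +>\<^bsub>poly_ring r\<^esub> q)"
    and "J +>\<^bsub>poly_ring r\<^esub> (p + q) =
      (J +>\<^bsub>poly_ring r\<^esub> p) \<oplus>\<^bsub>poly_ring r Quot J\<^esub> (J +>\<^bsub>poly_ring r\<^esub> q)"
  using ring_hom_mult[OF ideal.rcos_ring_hom[OF J] pq] ring_hom_add[OF ideal.rcos_ring_hom[OF J] pq]
  by simp_all

lemma single_0_in_carrier: "Poly_Mapping.single 0 c \<in> carrier (poly_ring r)"
  by (simp add: carrier_poly_ring_iff)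

text \<open>The coefficient field as a ring record. The scalars of a quotient are its image under a ring
homomorphism, which makes them a subfield.\<close>
definition scalar_field :: "'k::field ring" where
  "scalar_field = \<lparr>carrier = UNIV, mult = (*), one = 1, zero = 0, add = (+)\<rparr>"

lemma field_scalar_field: "field (scalar_field :: 'k::field ring)"
proof -
  have "cring (scalar_field :: 'k ring)"
  proof (rule cringI)
    show "abelian_group (scalar_field :: 'k ring)"
      by (rule abelian_groupI) (auto simp: scalar_field_def algebra_simps intro: exI[of _ "- _"])
    show "comm_monoid (scalar_field :: 'k ring)"
      by (rule comm_monoidI) (auto simp: scalar_field_def algebra_simps)
  qed (auto simp: scalar_field_def algebra_simps)
  moreover have "Units (scalar_field :: 'k ring) = carrier scalar_field - {\<zero>\<^bsub>scalar_field\<^esub>}"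
  proof -
    have "\<exists>y. y * x = 1 \<and> x * y = 1" if "x \<noteq> 0" for x :: 'k
      using that by (intro exI[of _ "inverse x"]) simp
    then show ?thesis by (auto simp: scalar_field_def Units_def)
  qed
  ultimately show ?thesis by (rule cring.cring_fieldI)
qed

text \<open>A ring homomorphism from a field to a nontrivial ring has a field as its image; the quotient
by an ideal is nontrivial when \<open>1\<close> is not in the ideal.\<close>
lemma subfield_quotient_scalars:
  fixes J :: "'k::field mvpoly set"
  assumes J: "ideal J (poly_ring r)" and "1 \<notin> J"
  shows "subfield (quotient_scalars r J) (poly_ring r Quot J)"
proof -
  let ?h = "\<lambda>c. J +>\<^bsub>poly_ring r\<^esub> Poly_Mapping.single 0 c"
  interpret J: ideal J "poly_ring r" by (rule J)
  interpret F: field "scalar_field :: 'k ring" by (rule field_scalar_field)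
  interpret Q: ring "poly_ring r Quot J" by (rule J.quotient_is_ring)
  have carr: "J +>\<^bsub>poly_ring r\<^esub> p \<in> carrier (poly_ring r Quot J)"
    if "p \<in> carrier (poly_ring r)" for p
    using ring_hom_closed[OF J.rcos_ring_hom that] .
  interpret h: ring_hom_ring "scalar_field :: 'k ring" "poly_ring r Quot J" ?h
  proof (rule ring_hom_ringI[OF F.ring_axioms Q.ring_axioms])
    show "?h \<one>\<^bsub>scalar_field\<^esub> = \<one>\<^bsub>poly_ring r Quot J\<^esub>"
      using ring_hom_one[OF J.rcos_ring_hom] by (simp add: scalar_field_def)
  qed (auto simp: scalar_field_def carr single_0_in_carrier single_add
      simp flip: quotient_ops[OF J single_0_in_carrier single_0_in_carrier] mult_single[of 0 _ 0, simplified])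
  have "J +>\<^bsub>poly_ring r\<^esub> 1 \<noteq> J +>\<^bsub>poly_ring r\<^esub> 0"
    using \<open>1 \<notin> J\<close> by (subst quotient_coset_eq_iff[OF J]) (auto simp: carrier_poly_ring_iff)
  then have "\<one>\<^bsub>poly_ring r Quot J\<^esub> \<noteq> \<zero>\<^bsub>poly_ring r Quot J\<^esub>"
    using ring_hom_one[OF J.rcos_ring_hom] by (simp add: quotient_zero[OF J])
  from h.img_is_subfield(2)[OF F.carrier_is_subfield this] show ?thesis
    by (simp add: quotient_scalars_def scalar_field_def)
qed

text \<open>If \<open>J \<inter> V\<close> is the common kernel in \<open>V\<close> of finitely many functionals, and \<open>V\<close> contains a
family dual to them, then the image of \<open>V\<close> modulo \<open>J\<close> has the cosets of that family as a basis.
The induction adds one functional at a time: for \<open>F \<subseteq> D\<close>, the cosets of the vectors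
killed by the functionals outside \<open>F\<close> form a space of dimension \<open>card F\<close>.\<close>
lemma dimension_quotient_dual_basis:
  fixes J V :: "'k::field mvpoly set" and S :: "'i \<Rightarrow> (nat \<Rightarrow>\<^sub>0 nat) set"
  assumes J: "ideal J (poly_ring r)"
    and V: "V \<subseteq> carrier (poly_ring r)" "0 \<in> V"
      "\<And>c p q. p \<in> V \<Longrightarrow> q \<in> V \<Longrightarrow> Poly_Mapping.single 0 c * p + q \<in> V"
    and D: "finite D" "\<And>t. t \<in> D \<Longrightarrow> v t \<in> V"
      "\<And>s t. s \<in> D \<Longrightarrow> t \<in> D \<Longrightarrow> coeff_sum (S s) (v t) = (if s = t then 1 else 0)"
    and kernel: "\<And>p. p \<in> V \<Longrightarrow> p \<in> J \<longleftrightarrow> (\<forall>t\<in>D. coeff_sum (S t) p = 0)"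
  shows "ring.dimension (poly_ring r Quot J) (card D) (quotient_scalars r J)
    ((\<lambda>p. J +>\<^bsub>poly_ring r\<^esub> p) ` V)"
proof -
  interpret J: ideal J "poly_ring r" by (rule J)
  interpret Q: ring "poly_ring r Quot J" by (rule J.quotient_is_ring)
  let ?c = "\<lambda>p. J +>\<^bsub>poly_ring r\<^esub> p"
  have Vc: "p \<in> carrier (poly_ring r)" if "p \<in> V" for p using V(1) that by blast
  have comb: "(?c (Poly_Mapping.single 0 k) \<otimes>\<^bsub>poly_ring r Quot J\<^esub> ?c p)
      \<oplus>\<^bsub>poly_ring r Quot J\<^esub> ?c q = ?c (Poly_Mapping.single 0 k * p + q)"
    if "p \<in> V" "q \<in> V" for k p q
  proof -
    have "Poly_Mapping.single 0 k * p \<in> carrier (poly_ring r)"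
      using J.m_closed[OF single_0_in_carrier Vc[OF that(1)]] by simp
    then show ?thesis
      by (simp only: quotient_ops(2)[OF J _ Vc[OF that(2)]]
          quotient_ops(1)[OF J single_0_in_carrier Vc[OF that(1)]])
  qed
  define E where "E F = ?c ` {p \<in> V. \<forall>t\<in>D - F. coeff_sum (S t) p = 0}" for F
  have "Q.dimension (card F) (quotient_scalars r J) (E F)" if "finite F" "F \<subseteq> D" for F
    using that
  proof (induction F rule: finite_induct)
    case empty
    have "?c p = ?c 0" if "p \<in> V" "\<forall>t\<in>D. coeff_sum (S t) p = 0" for p
      using that kernel[of p] Vc by (subst quotient_coset_eq_iff[OF J]) (auto simp: carrier_poly_ring_iff)
    then have "E {} \<subseteq> {?c 0}" unfolding E_def by blast
    moreover have "?c 0 \<in> E {}" unfolding E_def using V(2) by (intro imageI) simp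
    ultimately have "E {} = {\<zero>\<^bsub>poly_ring r Quot J\<^esub>}" unfolding quotient_zero[OF J] by blast
    then show ?case by simp
  next
    case (insert t F)
    then have t: "t \<in> D" and IH: "Q.dimension (card F) (quotient_scalars r J) (E F)" by auto
    \<comment> \<open>Functionals in \<open>D\<close> are constant on cosets of \<open>J\<close> within \<open>V\<close>, and the one for \<open>t\<close> separates \<open>v t\<close> from \<open>E F\<close>.\<close>
    have "?c (v t) \<notin> E F"
    proof
      assume "?c (v t) \<in> E F"
      then obtain p where p: "p \<in> V" "coeff_sum (S t) p = 0" "?c (v t) = ?c p"
        using t insert.hyps(2) by (auto simp: E_def)
      then have "v t - p \<in> J" using quotient_coset_eq_iff[OF J] Vc D(2)[OF t] by blast
      moreover have "v t - p \<in> V"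
        using V(3)[OF p(1) D(2)[OF t], of "-1"] by (simp add: single_uminus)
      ultimately have "coeff_sum (S t) (v t - p) = 0" using kernel t by blast
      then show False using D(3)[OF t t] p(2) by simp
    qed
    moreover have "?c (v t) \<in> carrier (poly_ring r Quot J)"
      using ring_hom_closed[OF J.rcos_ring_hom Vc[OF D(2)[OF t]]] .
    ultimately have "Q.dimension (Suc (card F)) (quotient_scalars r J)
        (Q.line_extension (quotient_scalars r J) (?c (v t)) (E F))"
      using IH by (intro Q.dimension.Suc_dim)
    moreover have "Q.line_extension (quotient_scalars r J) (?c (v t)) (E F) = E (insert t F)"
    proof (intro equalityI subsetI)
      fix x assume "x \<in> Q.line_extension (quotient_scalars r J) (?c (v t)) (E F)"
      then obtain k p where p: "p \<in> V" "\<forall>s\<in>D - F. coeff_sum (S s) p = 0"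
        and x: "x = ?c (Poly_Mapping.single 0 k * v t + p)"
        using comb[OF D(2)[OF t]]
        unfolding Q.line_extension_mem_iff quotient_scalars_def E_def by auto
      show "x \<in> E (insert t F)"
        unfolding E_def x using p V(3)[OF D(2)[OF t] p(1)] D(3)[OF _ t] by (intro imageI) auto
    next
      fix x assume "x \<in> E (insert t F)"
      then obtain p where p: "p \<in> V" "\<forall>s\<in>D - insert t F. coeff_sum (S s) p = 0" and x: "x = ?c p"
        by (auto simp: E_def)
      define k where "k = coeff_sum (S t) p"
      define q where "q = Poly_Mapping.single 0 (- k) * v t + p"
      have q: "q \<in> V" unfolding q_def by (rule V(3)[OF D(2)[OF t] p(1)])
      moreover have "coeff_sum (S s) q = 0" if "s \<in> D - F" for s
        using that p(2) D(3)[OF _ t, of s] by (cases "s = t") (auto simp: q_def k_def)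
      ultimately have "?c q \<in> E F" by (auto simp: E_def)
      moreover have "p = Poly_Mapping.single 0 k * v t + q"
        by (simp add: q_def single_uminus)
      then have "x = (?c (Poly_Mapping.single 0 k) \<otimes>\<^bsub>poly_ring r Quot J\<^esub> ?c (v t))
          \<oplus>\<^bsub>poly_ring r Quot J\<^esub> ?c q"
        using comb[OF D(2)[OF t] q] x by simp
      ultimately show "x \<in> Q.line_extension (quotient_scalars r J) (?c (v t)) (E F)"
        unfolding Q.line_extension_mem_iff quotient_scalars_def by blast
    qed
    ultimately show ?case using insert.hyps by simp
  qed
  from this[OF D(1)] show ?thesis by (simp add: E_def)
qed

section \<open>Successive quotients of the ideals\<close>

text \<open>Every threshold above all lengths of \<open>0\<close> is a cut, and the functional belonging to it takes the
value \<open>1\<close> at the polynomial \<open>1\<close>.\<close>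
lemma one_notin_length_diff_ideal:
  fixes \<alpha> :: "nat \<Rightarrow> 'a::cancel_comm_monoid_add"
  assumes "finite (length_set r \<alpha> 0)"
  shows "1 \<notin> (length_diff_ideal G r \<alpha> j :: 'k::field mvpoly set)"
proof
  assume one: "1 \<in> (length_diff_ideal G r \<alpha> j :: 'k::field mvpoly set)"
  obtain W where "\<And>l. l \<in> length_set r \<alpha> 0 \<Longrightarrow> l \<le> W"
    using assms by (meson finite_nat_set_iff_bounded_le)
  then have "cut r \<alpha> 0 j W" by (force simp: cut_def)
  from coeff_sum_length_diff_ideal[OF one this]
  have "coeff_sum (short_factorizations r \<alpha> 0 W) (Poly_Mapping.single 0 1 :: 'k mvpoly) = 0" by simp
  moreover have "0 \<in> short_factorizations r \<alpha> 0 W"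
    by (simp add: short_factorizations_def zero_in_factorizations)
  ultimately show False by (simp del: single_one)
qed

text \<open>Take \<open>y\<^sup>a - y\<^sup>b\<close> with the lengths of \<open>a\<close> and \<open>b\<close> the two ends \<open>t\<close> and \<open>t + j\<close> of a gap.
A threshold \<open>s\<close> separates them iff \<open>t \<le> s < t + j\<close>, and the only length in that range
is \<open>t\<close>.\<close>
lemma gap_dual_binomials:
  fixes \<alpha> :: "nat \<Rightarrow> 'a::cancel_comm_monoid_add"
  assumes "\<beta> \<in> G"
  obtains v :: "nat \<Rightarrow> 'k::field mvpoly" where
    "\<And>t. t \<in> gap_starts r \<alpha> \<beta> j \<Longrightarrow> v t \<in> length_diff_ideal G r \<alpha> j \<inter> homogeneous_part r \<alpha> \<beta>"
    "\<And>s t. s \<in> gap_starts r \<alpha> \<beta> j \<Longrightarrow> t \<in> gap_starts r \<alpha> \<beta> j \<Longrightarrow> 0 < j \<Longrightarrow>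
      coeff_sum (short_factorizations r \<alpha> \<beta> s) (v t) = (if s = t then 1 else 0)"
proof -
  have "\<exists>a b. a \<in> factorizations r \<alpha> \<beta> \<and> b \<in> factorizations r \<alpha> \<beta> \<and>
      fact_length r a = t \<and> fact_length r b = t + j" if "t \<in> gap_starts r \<alpha> \<beta> j" for t
    using that by (fastforce simp: gap_starts_def length_set_def)
  then obtain a b where ab: "\<And>t. t \<in> gap_starts r \<alpha> \<beta> j \<Longrightarrow> a t \<in> factorizations r \<alpha> \<beta> \<and>
      b t \<in> factorizations r \<alpha> \<beta> \<and> fact_length r (a t) = t \<and> fact_length r (b t) = t + j"
    by metis
  show ?thesis
  proof (rule that[of "\<lambda>t. monomial (a t) - monomial (b t)"])
    fix t assume t: "t \<in> gap_starts r \<alpha> \<beta> j"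
    have "monomial (a t) - monomial (b t) \<in> (length_diff_ideal G r \<alpha> j :: 'k mvpoly set)"
      using ab[OF t] by (intro binomial_in_length_diff_ideal[OF assms]) auto
    moreover have "Poly_Mapping.keys (monomial (a t) - monomial (b t) :: 'k mvpoly) \<subseteq> {a t, b t}"
      by (auto simp: in_keys_iff lookup_minus lookup_single when_def split: if_splits)
    ultimately show "monomial (a t) - monomial (b t) \<in>
        length_diff_ideal G r \<alpha> j \<inter> (homogeneous_part r \<alpha> \<beta> :: 'k mvpoly set)"
      using ab[OF t] by (auto simp: homogeneous_part_def)
    fix s assume s: "s \<in> gap_starts r \<alpha> \<beta> j" and "0 < j"
    have "t \<notin> {s<..<s + j}" "s \<notin> {t<..<t + j}"
      using s t unfolding gap_starts_def by blast+
    then show "coeff_sum (short_factorizations r \<alpha> \<beta> s)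
        (monomial (a t) - monomial (b t) :: 'k mvpoly) = (if s = t then 1 else 0)"
      using ab[OF t] \<open>0 < j\<close> by (auto simp: short_factorizations_def)
  qed
qed

text \<open>An element of \<open>I\<^bsub>j+1\<^esub>\<close> already satisfies the conditions at the cuts for \<open>j + 1\<close>, so membership in
\<open>I\<^sub>j\<close> is decided by the cuts for \<open>j\<close> that are lost at \<open>j + 1\<close>.\<close>
lemma length_diff_ideal_step_iff:
  fixes \<alpha> :: "nat \<Rightarrow> 'a::cancel_comm_monoid_add" and p :: "'k::field mvpoly"
  assumes "\<beta> \<in> G" "finite (length_set r \<alpha> \<beta>)"
    and p: "p \<in> length_diff_ideal G r \<alpha> (Suc j) \<inter> homogeneous_part r \<alpha> \<beta>"
  shows "p \<in> length_diff_ideal G r \<alpha> j \<longleftrightarrow>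
    (\<forall>t\<in>gap_starts r \<alpha> \<beta> (Suc j). coeff_sum (short_factorizations r \<alpha> \<beta> t) p = 0)"
proof
  assume pj: "p \<in> length_diff_ideal G r \<alpha> j"
  show "\<forall>t\<in>gap_starts r \<alpha> \<beta> (Suc j). coeff_sum (short_factorizations r \<alpha> \<beta> t) p = 0"
  proof
    fix t assume t: "t \<in> gap_starts r \<alpha> \<beta> (Suc j)"
    then have "t \<in> length_set r \<alpha> \<beta>" by (simp add: gap_starts_def)
    then have "cut r \<alpha> \<beta> j t" using t cut_iff_Suc by blast
    then show "coeff_sum (short_factorizations r \<alpha> \<beta> t) p = 0"
      by (rule coeff_sum_length_diff_ideal[OF pj])
  qed
next
  assume gaps: "\<forall>t\<in>gap_starts r \<alpha> \<beta> (Suc j). coeff_sum (short_factorizations r \<alpha> \<beta> t) p = 0"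
  show "p \<in> length_diff_ideal G r \<alpha> j"
  proof (rule in_length_diff_idealI[OF assms(1,2)])
    fix t assume t: "t \<in> length_set r \<alpha> \<beta>" "cut r \<alpha> \<beta> j t"
    from iffD1[OF cut_iff_Suc[OF t(1)] t(2)]
    show "coeff_sum (short_factorizations r \<alpha> \<beta> t) p = 0"
    proof
      assume "cut r \<alpha> \<beta> (Suc j) t"
      then show ?thesis using p by (intro coeff_sum_length_diff_ideal[of p G r \<alpha> "Suc j"]) auto
    qed (use gaps in blast)
  qed (use p in blast)
qed

lemma hilbert_function_length_diff_quotient:
  fixes \<alpha> :: "nat \<Rightarrow> 'a::cancel_comm_monoid_add"
  assumes \<beta>: "\<beta> \<in> G" and fin: "finite (length_set r \<alpha> \<beta>)" "finite (length_set r \<alpha> 0)"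
  defines "I \<equiv> (length_diff_ideal G r \<alpha> :: nat \<Rightarrow> 'k::field mvpoly set)"
  shows "finite_dim_part r \<alpha> (I (Suc j)) (I j) \<beta>"
    and "hilbert_function r \<alpha> (I (Suc j)) (I j) \<beta> = card (gap_indices r \<alpha> \<beta> (Suc j))"
proof -
  have J: "ideal (I j) (poly_ring r)" for j
    unfolding I_def by (rule ideal_length_diff_ideal)
  define V where "V = I (Suc j) \<inter> homogeneous_part r \<alpha> \<beta>"
  obtain v :: "nat \<Rightarrow> 'k mvpoly" where v: "\<And>t. t \<in> gap_starts r \<alpha> \<beta> (Suc j) \<Longrightarrow> v t \<in> V"
    "\<And>s t. s \<in> gap_starts r \<alpha> \<beta> (Suc j) \<Longrightarrow> t \<in> gap_starts r \<alpha> \<beta> (Suc j) \<Longrightarrow>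
      coeff_sum (short_factorizations r \<alpha> \<beta> s) (v t) = (if s = t then 1 else 0)"
    using gap_dual_binomials[OF \<beta>, of r \<alpha> "Suc j"] unfolding V_def I_def
    by (metis zero_less_Suc)
  interpret Q: ring "poly_ring r Quot I j" by (rule ideal.quotient_is_ring[OF J])
  have "Q.dimension (card (gap_starts r \<alpha> \<beta> (Suc j))) (quotient_scalars r (I j))
      ((\<lambda>p. I j +>\<^bsub>poly_ring r\<^esub> p) ` V)"
  proof (rule dimension_quotient_dual_basis[OF J, where S = "short_factorizations r \<alpha> \<beta>" and v = v])
    show "V \<subseteq> carrier (poly_ring r)" "0 \<in> V"
      using poly_ring_ideal_closed(1,5)[OF J] by (auto simp: V_def homogeneous_part_def)
    show "finite (gap_starts r \<alpha> \<beta> (Suc j))"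
      using fin(1) by (simp add: gap_starts_def)
    show "p \<in> I j \<longleftrightarrow> (\<forall>t\<in>gap_starts r \<alpha> \<beta> (Suc j). coeff_sum (short_factorizations r \<alpha> \<beta> t) p = 0)"
      if "p \<in> V" for p
      using length_diff_ideal_step_iff[OF \<beta> fin(1)] that unfolding V_def I_def by blast
    fix c and p q :: "'k mvpoly" assume pq: "p \<in> V" "q \<in> V"
    have "Poly_Mapping.single 0 c * p + q \<in> I (Suc j)"
      using pq by (intro poly_ring_ideal_closed(2,4)[OF J] single_0_in_carrier) (auto simp: V_def)
    moreover have "Poly_Mapping.keys (Poly_Mapping.single 0 c * p) \<subseteq> Poly_Mapping.keys p"
      using keys_mult[of "Poly_Mapping.single 0 c" p] by (auto split: if_splits)
    then have "Poly_Mapping.keys (Poly_Mapping.single 0 c * p + q) \<subseteq>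
        Poly_Mapping.keys p \<union> Poly_Mapping.keys q"
      using Poly_Mapping.keys_add[of "Poly_Mapping.single 0 c * p" q] by blast
    ultimately show "Poly_Mapping.single 0 c * p + q \<in> V"
      using pq by (auto simp: V_def homogeneous_part_def)
  qed (use v in auto)
  moreover have "(\<lambda>p. I j +>\<^bsub>poly_ring r\<^esub> p) ` V = quotient_part r \<alpha> (I (Suc j)) (I j) \<beta>"
    by (auto simp: quotient_part_def V_def)
  ultimately have dim: "Q.dimension (card (gap_indices r \<alpha> \<beta> (Suc j))) (quotient_scalars r (I j))
      (quotient_part r \<alpha> (I (Suc j)) (I j) \<beta>)"
    using bij_betw_same_card[OF bij_betw_gap_indices_gap_starts[OF fin(1), of "Suc j"]] by simp
  then show "finite_dim_part r \<alpha> (I (Suc j)) (I j) \<beta>"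
    unfolding finite_dim_part_def by (rule Q.finite_dimensionI)
  have "subfield (quotient_scalars r (I j)) (poly_ring r Quot I j)"
    using one_notin_length_diff_ideal[OF fin(2)] unfolding I_def
    by (intro subfield_quotient_scalars ideal_length_diff_ideal)
  from Q.dimI[OF this dim]
  show "hilbert_function r \<alpha> (I (Suc j)) (I j) \<beta> = card (gap_indices r \<alpha> \<beta> (Suc j))"
    by (simp add: hilbert_function_def over_def)
qed

text \<open>If no element of \<open>G\<close> has a gap of size \<open>j + 1\<close>, the generators of \<open>I\<^bsub>j+1\<^esub>\<close> have no
further condition to satisfy and lie in \<open>I\<^sub>j\<close>; if there is such a gap, the dual binomial of its start is not in \<open>I\<^sub>j\<close>.\<close>
lemma length_diff_ideal_psubset_iff:
  fixes \<alpha> :: "nat \<Rightarrow> 'a::cancel_comm_monoid_add" and G :: "'a set"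
  assumes fin: "\<And>\<beta>. finite (length_set r \<alpha> \<beta>)"
  defines "I \<equiv> (length_diff_ideal G r \<alpha> :: nat \<Rightarrow> 'k::field mvpoly set)"
  shows "I j \<subset> I (Suc j) \<longleftrightarrow> Suc j \<in> monoid_delta_set G r \<alpha>"
proof -
  have delta: "Suc j \<in> monoid_delta_set G r \<alpha> \<longleftrightarrow> (\<exists>\<beta>\<in>G. gap_starts r \<alpha> \<beta> (Suc j) \<noteq> {})"
    using delta_set_iff_gap_starts[OF fin, of "Suc j"] by (auto simp: monoid_delta_set_def)
  have sub: "I j \<subseteq> I (Suc j)" unfolding I_def by (rule length_diff_ideal_mono) simp
  show ?thesis
    unfolding delta
  proof
    assume "I j \<subset> I (Suc j)"
    show "\<exists>\<beta>\<in>G. gap_starts r \<alpha> \<beta> (Suc j) \<noteq> {}"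
    proof (rule ccontr)
      assume no_gaps: "\<not> ?thesis"
      have "I (Suc j) \<subseteq> I j"
        unfolding I_def
      proof (rule length_diff_ideal_subsetI[OF ideal_length_diff_ideal])
        fix a b \<beta>
        assume \<beta>: "\<beta> \<in> G" and ab: "a \<in> factorizations r \<alpha> \<beta>" "b \<in> factorizations r \<alpha> \<beta>"
          and len: "fact_length r a \<le> fact_length r b + Suc j" "fact_length r b \<le> fact_length r a + Suc j"
        have "monomial a - monomial b \<in> (length_diff_ideal G r \<alpha> (Suc j) :: 'k mvpoly set)"
          by (rule binomial_in_length_diff_ideal[OF \<beta> ab len])
        moreover have "Poly_Mapping.keys (monomial a - monomial b :: 'k mvpoly) \<subseteq> {a, b}"
          by (auto simp: in_keys_iff lookup_minus lookup_single when_def split: if_splits)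
        then have "monomial a - monomial b \<in> (homogeneous_part r \<alpha> \<beta> :: 'k mvpoly set)"
          using ab by (auto simp: homogeneous_part_def)
        ultimately show "monomial a - monomial b \<in> (length_diff_ideal G r \<alpha> j :: 'k mvpoly set)"
          using length_diff_ideal_step_iff[OF \<beta> fin] no_gaps \<beta> by blast
      qed
      then show False using \<open>I j \<subset> I (Suc j)\<close> by blast
    qed
  next
    assume "\<exists>\<beta>\<in>G. gap_starts r \<alpha> \<beta> (Suc j) \<noteq> {}"
    then obtain \<beta> t where \<beta>: "\<beta> \<in> G" and t: "t \<in> gap_starts r \<alpha> \<beta> (Suc j)" by blast
    obtain v :: "nat \<Rightarrow> 'k mvpoly" where
      "v t \<in> length_diff_ideal G r \<alpha> (Suc j) \<inter> homogeneous_part r \<alpha> \<beta>"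
      "coeff_sum (short_factorizations r \<alpha> \<beta> t) (v t) = 1"
      using gap_dual_binomials[OF \<beta>, of r \<alpha> "Suc j"] t by (metis zero_less_Suc)
    then have "v t \<in> I (Suc j) - I j"
      using length_diff_ideal_step_iff[OF \<beta> fin, of "v t" j] t by (auto simp: I_def)
    then show "I j \<subset> I (Suc j)" using sub by blast
  qed
qed

section \<open>Finiteness of length sets\<close>

lemma submonoid_generated_props:
  "0 \<in> submonoid_generated S" "x \<in> S \<Longrightarrow> x \<in> submonoid_generated S"
  "x \<in> submonoid_generated S \<Longrightarrow> y \<in> submonoid_generated S \<Longrightarrow> x + y \<in> submonoid_generated S"
  by (auto simp: submonoid_generated_def)

lemma nat_scale_in_submonoid_generated:
  "x \<in> submonoid_generated S \<Longrightarrow> nat_scale n x \<in> submonoid_generated S"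
  by (induction n) (auto intro: submonoid_generated_props)

lemma minimal_generators_nonzero:
  assumes "minimal_generators G r \<alpha>" "i < r"
  shows "\<alpha> i \<noteq> 0"
proof
  assume zero: "\<alpha> i = 0"
  have "submonoid_generated (\<alpha> ` {..<r} - {0}) = submonoid_generated (\<alpha> ` {..<r})"
    unfolding submonoid_generated_def by (intro arg_cong[of _ _ Inter] Collect_cong) auto
  moreover have "\<alpha> ` {..<r} - {0} \<subset> \<alpha> ` {..<r}" using zero assms(2) by force
  ultimately show False using assms(1) by (auto simp: minimal_generators_def)
qed

text \<open>By the pigeonhole principle two multiples of \<open>x\<close> agree, and by cancellation some positive multiple of
\<open>x\<close> is \<open>0\<close>. Then \<open>x\<close> is invertible.\<close>
lemma reduced_monoid_torsion_free:
  fixes x :: "'a::cancel_comm_monoid_add"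
  assumes red: "reduced_monoid (submonoid_generated S)" and x: "x \<in> submonoid_generated S"
    and fin: "finite (range (\<lambda>n. nat_scale n x))"
  shows "x = 0"
proof -
  have "\<not> inj (\<lambda>n. nat_scale n x)" using fin finite_imageD infinite_UNIV_nat by blast
  then obtain m n where mn: "m < n" "nat_scale m x = nat_scale n x"
    unfolding inj_def by (metis linorder_neqE_nat)
  obtain k where k: "n = m + Suc k" using less_imp_Suc_add[OF mn(1)] by auto
  have "nat_scale m x + nat_scale (Suc k) x = nat_scale m x + 0"
    using mn(2) nat_scale_add[of m "Suc k" x] by (simp only: k add_0_right)
  then have "x + nat_scale k x = 0" unfolding add_left_cancel by (simp add: add.commute)
  then show ?thesis
    using red x nat_scale_in_submonoid_generated[OF x] by (auto simp: reduced_monoid_def)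
qed

text \<open>The sum of the \<open>\<nat>\<^sup>d\<close> coordinates is additive and at least \<open>1\<close> on each generator: otherwise all
multiples of the generator would lie in the finite group \<open>0 \<times> T\<close>, which makes the generator
\<open>0\<close> by reducedness and thus contradicts minimality.\<close>
lemma finite_length_set:
  fixes \<alpha> :: "nat \<Rightarrow> (nat ^ 'd::finite) \<times> ('t::{finite, ab_group_add})"
  assumes \<Gamma>: "\<Gamma> = submonoid_generated (\<alpha> ` {..<r})"
    and red: "reduced_monoid \<Gamma>" and min: "minimal_generators \<Gamma> r \<alpha>"
  shows "finite (length_set r \<alpha> \<beta>)"
proof -
  define w where "w x = (\<Sum>k\<in>UNIV. fst x $ k)" for x :: "(nat ^ 'd) \<times> 't"
  have w_add: "w (x + y) = w x + w y" for x y by (simp add: w_def sum.distrib)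
  have w_0: "w 0 = 0" by (simp add: w_def)
  have w_scale: "w (nat_scale n x) = n * w x" for n x by (induction n) (simp_all add: w_0 w_add)
  have w_sum: "w (\<Sum>i\<in>A. f i) = (\<Sum>i\<in>A. w (f i))" if "finite A" for A :: "nat set" and f
    using that by (induction A rule: finite_induct) (simp_all add: w_0 w_add)
  have pos: "1 \<le> w (\<alpha> i)" if "i < r" for i
  proof (rule ccontr)
    assume "\<not> 1 \<le> w (\<alpha> i)"
    then have w0: "w (\<alpha> i) = 0" by simp
    have "nat_scale n (\<alpha> i) \<in> Pair 0 ` UNIV" for n
    proof -
      have "w (nat_scale n (\<alpha> i)) = 0" by (simp add: w_scale w0)
      then have "fst (nat_scale n (\<alpha> i)) = 0" by (simp add: w_def vec_eq_iff)
      then show ?thesis by (metis prod.collapse rangeI)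
    qed
    then have "range (\<lambda>n. nat_scale n (\<alpha> i)) \<subseteq> Pair 0 ` UNIV" by blast
    then have "finite (range (\<lambda>n. nat_scale n (\<alpha> i)))" by (rule finite_subset) simp
    moreover have "\<alpha> i \<in> submonoid_generated (\<alpha> ` {..<r})"
      using that by (intro submonoid_generated_props) auto
    ultimately have "\<alpha> i = 0" using red reduced_monoid_torsion_free unfolding \<Gamma> by blast
    then show False using minimal_generators_nonzero[OF min that] by contradiction
  qed
  have "fact_length r a \<le> w \<beta>" if "a \<in> factorizations r \<alpha> \<beta>" for a
  proof -
    have "fact_length r a \<le> (\<Sum>i<r. Poly_Mapping.lookup a i * w (\<alpha> i))"
      unfolding fact_length_def using pos by (intro sum_mono) auto
    also have "\<dots> = w (\<Sum>i<r. nat_scale (Poly_Mapping.lookup a i) (\<alpha> i))"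
      by (simp add: w_sum w_scale)
    also have "\<dots> = w \<beta>" using that by (simp add: factorizations_def)
    finally show ?thesis .
  qed
  then have "length_set r \<alpha> \<beta> \<subseteq> {..w \<beta>}" by (auto simp: length_set_def)
  then show ?thesis by (rule finite_subset) simp
qed

theorem theorem4p9:
  fixes r :: nat
    and \<alpha> :: "nat \<Rightarrow> (nat ^ 'd::finite) \<times> ('t::{finite, ab_group_add})"
    and \<Gamma> :: "((nat ^ 'd) \<times> 't) set"
    and I :: "nat \<Rightarrow> 'k::field mvpoly set"
  assumes \<Gamma>: "\<Gamma> = submonoid_generated (\<alpha> ` {..<r})"
    and reduced: "reduced_monoid \<Gamma>"
    and minimal: "minimal_generators \<Gamma> r \<alpha>"
    and I: "\<And>j. I j = length_diff_ideal \<Gamma> r \<alpha> j"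
  shows "(length_set_ideal \<Gamma> r \<alpha> = I 0 \<and> (\<forall>j. I j \<subseteq> I (Suc j))) \<and>
    (\<forall>j\<ge>1. \<forall>\<beta>\<in>\<Gamma>.
       finite_dim_part r \<alpha> (I j) (I (j - 1)) \<beta> \<and>
       hilbert_function r \<alpha> (I j) (I (j - 1)) \<beta> = card (gap_indices r \<alpha> \<beta> j)) \<and>
    (\<forall>j\<ge>1. I (j - 1) \<subset> I j \<longleftrightarrow> j \<in> monoid_delta_set \<Gamma> r \<alpha>)"
proof -
  note fin = finite_length_set[OF \<Gamma> reduced minimal]
  have Suc: "\<exists>i. j = Suc i" if "j \<ge> 1" for j
    using that by (cases j) auto
  show ?thesis
  proof (intro conjI allI impI ballI)
    show "length_set_ideal \<Gamma> r \<alpha> = I 0" unfolding I by (rule length_set_ideal_eq)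
    show "I j \<subseteq> I (Suc j)" for j unfolding I by (rule length_diff_ideal_mono) simp
    fix j :: nat assume "j \<ge> 1"
    then obtain i where i: "j = Suc i" using Suc by blast
    show "I (j - 1) \<subset> I j \<longleftrightarrow> j \<in> monoid_delta_set \<Gamma> r \<alpha>"
      unfolding I i using length_diff_ideal_psubset_iff[OF fin] by simp
    fix \<beta> assume "\<beta> \<in> \<Gamma>"
    from hilbert_function_length_diff_quotient[OF this fin fin, of i]
    show "finite_dim_part r \<alpha> (I j) (I (j - 1)) \<beta>"
      "hilbert_function r \<alpha> (I j) (I (j - 1)) \<beta> = card (gap_indices r \<alpha> \<beta> j)"
      unfolding I i by simp_all
  qed
qed

end
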